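(* Let $(X_j,d_j,T_j)$, $j\in\mathbb{N}$, be precompact integral current spaces. Suppose that there exist a compact metric space $(X,d)$ and a non-zero integral current space $(Y,d,T)$ with $Y\subset X$ such that $$(\bar X_j,d_j)\to(X,d)\ \text{ in the Gromov-Hausdorff (GH) sense}\quad\text{and}\quad(X_j,d_j,T_j)\to(Y,d,T)\ \text{ in the Sormani-Wenger intrinsic flat (SWIF) sense},$$ and that there is a subsequence $\{j_k\}$ such that $$(\partial X_{j_k},d_{j_k})\to(X_\partial,d)\ \text{ in the GH sense},$$ where $\partial X_{j_k}=\bar X_{j_k}\setminus X_{j_k}$ and $X_\partial\subset X$. Suppose in addition that $X_\partial\subset\bar Y$, and that there is a decreasing sequence of positive numbers $\delta_i\to0$ such that, for every $i$, the inner regions converge, $$(\overline{X_{j_k}^{\delta_i}},d_{j_k})\to X(\delta_i)\ \text{ in the GH sense as }k\to\infty,$$ with $X(\delta_i)\subset Y$ for all $i\in\mathbb{N}$. Then $X=\bar Y$.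
   Context: **Boundary and inner regions.** For a metric space $(X,d)$, $\bar X$ is its metric completion, $\partial X:=\bar X\setminus X$, and for $\delta>0$, $X^\delta:=\{x\in X:d(x,\partial X)>\delta\}$. Subsets carry restricted metrics. **Currents (Ambrosio-Kirchheim).** For a complete metric space $Z$, $\mathcal{D}^m(Z)$ is the set of tuples $(f,\pi_1,\dots,\pi_m)$ of real Lipschitz functions on $Z$ with $f$ bounded. An $m$-dimensional current is a multilinear $T:\mathcal{D}^m(Z)\to\mathbb{R}$ such that: $T(f,\pi)=0$ if some $\pi_i$ is constant on a neighborhood of $\{f\ne0\}$; $T$ is continuous under pointwise convergence of the $\pi_i$ with $\operatorname{Lip}(\pi_i)\le1$; and there is a finite Borel measure $\mu$ with $|T(f,\pi)|\le\prod_i\operatorname{Lip}(\pi_i)\int_Z|f|\,d\mu$. The smallest such $\mu$ is the mass measure $\|T\|$, and $\mathbf{M}(T)=\|T\|(Z)$. Push-forward under a Lipschitz map $\varphi$: $\varphi_\#T(f,\pi)=T(f\circ\varphi,\pi_1\circ\varphi,\dots,\pi_m\circ\varphi)$. For $A\subset\mathbb{R}^m$ and integer valued $\theta\in L^1(A)$, $[[\theta]](f,\pi)=\int_A\theta f\det(\nabla\pi_i)\,d\mathcal{L}^m$. $T$ is integer rectifiable if $T=\sum_i\varphi_{i\#}[[\theta_i]]$ and $\mathbf{M}(T)=\sum_i\mathbf{M}(\varphi_{i\#}[[\theta_i]])$ for countably many bilipschitz maps $\varphi_i:A_i\subset\mathbb{R}^m\to Z$ with $A_i$ precompact Borel, with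 pairwise disjoint images, and $\theta_i\in L^1(A_i,\mathbb{N})$. Boundary: $\partial T(f,\pi_1,\dots,\pi_{m-1})=T(1,f,\pi_1,\dots,\pi_{m-1})$. $T$ is an integral current, $T\in\mathbf{I}_m(Z)$, if it is integer rectifiable and $\partial T$ is a current (of finite mass). $\operatorname{set}(T)=\{p\in Z:\liminf_{r\to0}\|T\|(B(p,r))/(\omega_mr^m)>0\}$, where $\omega_m$ is the volume of the unit ball of $\mathbb{R}^m$. **Integral current spaces and SWIF convergence (Sormani-Wenger).** An $m$-dimensional integral current space $(Y,d,T)$ is a metric space $(Y,d)$ with $T\in\mathbf{I}_m(\bar Y)$ and $\operatorname{set}(T)=Y$; there is also the zero integral current space $\mathbf{0}$, with $T=0$. It is precompact if $Y$ is precompact. The SWIF distance between $(Y_1,d_1,T_1)$ and $(Y_2,d_2,T_2)$ (of the same dimension $m$) is the infimum of $\mathbf{M}(U)+\mathbf{M}(V)$ over all complete metric spaces $Z$, isometric (distance-preserving) embeddings $\varphi_i:\bar Y_i\to Z$ and $U\in\mathbf{I}_m(Z)$, $V\in\mathbf{I}_{m+1}(Z)$ with $\varphi_{1\#}T_1-\varphi_{2\#}T_2=U+\partial V$. SWIF convergence is convergence in this distance. **Conventions.** When $(\bar X_j,d_j)$ GH converges to $X$, one fixes isometric embeddings of the $\bar X_j$ and of $X$ into a common compact metric space in which (after passing to a subsequence) the images Hausdorff converge. Points $x_j\in\bar X_j$ converge to $x\in X$ if their images do, and the limits $X_\partial$ and $X(\delta_i)$ are the subsets of $X$ that are the Hausdorff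 limits of the images of $\partial X_{j_k}$ and $\overline{X_{j_k}^{\delta_i}}$. $\bar Y$ is the closure of $Y$ in $X$. *)

theory Defs
  imports
    "HOL-Analysis.Analysis"
    "Jordan_Normal_Form.Determinant"
begin

section \<open>Metric spaces\<close>

text \<open>
  Metric spaces are elements of the library type \<^typ>\<open>'a metric\<close>, so that they can be
  quantified over. A space \<open>X\<close> together with its completion is encoded as a complete metric space
  \<open>Xb\<close> and a dense subset \<open>X\<close> of it, with the restricted metric.
\<close>

definition completion_of :: "'a metric \<Rightarrow> 'a set \<Rightarrow> bool" where
  "completion_of Xb X \<longleftrightarrow>
     mcomplete_of Xb \<and> X \<subseteq> mspace Xb \<and> mtopology_of Xb closure_of X = mspace Xb"

definition metric_boundary :: "'a metric \<Rightarrow> 'a set \<Rightarrow> 'a set" where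
  "metric_boundary Xb X = mspace Xb - X"

text \<open>The infimum is taken in the extended reals: the distance to an empty boundary is infinite,
  so that the inner regions of a complete space are the whole space.\<close>

definition inner_region :: "'a metric \<Rightarrow> 'a set \<Rightarrow> real \<Rightarrow> 'a set" where
  "inner_region Xb X \<delta> =
     {x \<in> X. (INF y\<in>metric_boundary Xb X. ereal (mdist Xb x y)) > ereal \<delta>}"

definition isometric_embedding :: "'a metric \<Rightarrow> 'b metric \<Rightarrow> ('a \<Rightarrow> 'b) \<Rightarrow> bool" where
  "isometric_embedding A B \<phi> \<longleftrightarrow>
     \<phi> \<in> mspace A \<rightarrow> mspace B \<and>
     (\<forall>x\<in>mspace A. \<forall>y\<in>mspace A. mdist B (\<phi> x) (\<phi> y) = mdist A x y)"

definition bilipschitz :: "'a metric \<Rightarrow> 'b metric \<Rightarrow> ('a \<Rightarrow> 'b) \<Rightarrow> bool" where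
  "bilipschitz A B \<phi> \<longleftrightarrow>
     \<phi> \<in> mspace A \<rightarrow> mspace B \<and>
     (\<exists>L>0. \<forall>x\<in>mspace A. \<forall>y\<in>mspace A.
        mdist A x y / L \<le> mdist B (\<phi> x) (\<phi> y) \<and> mdist B (\<phi> x) (\<phi> y) \<le> L * mdist A x y)"

text \<open>The Hausdorff distance is infinite between the empty set and a nonempty set.\<close>

definition hausdorff_dist :: "'a metric \<Rightarrow> 'a set \<Rightarrow> 'a set \<Rightarrow> ennreal" where
  "hausdorff_dist Z A B =
     Inf {ennreal r | r. 0 < r \<and> (\<forall>a\<in>A. \<exists>b\<in>B. mdist Z a b < r) \<and>
                                (\<forall>b\<in>B. \<exists>a\<in>A. mdist Z a b < r)}"

definition hausdorff_converges :: "'a metric \<Rightarrow> (nat \<Rightarrow> 'a set) \<Rightarrow> 'a set \<Rightarrow> bool" where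
  "hausdorff_converges Z A B \<longleftrightarrow> (\<lambda>k. hausdorff_dist Z (A k) B) \<longlonglongrightarrow> 0"

text \<open>The ambient space may be replaced by the union of the two embedded images, which has at most
  as many points as the disjoint union; hence carriers in the sum type give the infimum over all
  metric spaces.\<close>

definition GH_dist :: "'a metric \<Rightarrow> 'b metric \<Rightarrow> ennreal" where
  "GH_dist A B =
     Inf {hausdorff_dist Z (\<phi> ` mspace A) (\<psi> ` mspace B) | (Z :: ('a + 'b) metric) \<phi> \<psi>.
            isometric_embedding A Z \<phi> \<and> isometric_embedding B Z \<psi>}"


section \<open>Currents in metric spaces (Ambrosio--Kirchheim)\<close>

abbreviation Lipschitz_fun :: "'a metric \<Rightarrow> ('a \<Rightarrow> real) \<Rightarrow> bool" where
  "Lipschitz_fun Z f \<equiv> Lipschitz_continuous_map Z euclidean_metric f"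

definition Lip :: "'a metric \<Rightarrow> ('a \<Rightarrow> real) \<Rightarrow> real" where
  "Lip Z f =
     Inf {L. 0 \<le> L \<and> (\<forall>x\<in>mspace Z. \<forall>y\<in>mspace Z. \<bar>f x - f y\<bar> \<le> L * mdist Z x y)}"

definition metric_forms :: "nat \<Rightarrow> 'a metric \<Rightarrow> (('a \<Rightarrow> real) \<times> ('a \<Rightarrow> real) list) set" where
  "metric_forms m Z =
     {(f, \<pi>). Lipschitz_fun Z f \<and> bounded (f ` mspace Z) \<and>
              length \<pi> = m \<and> (\<forall>p\<in>set \<pi>. Lipschitz_fun Z p)}"

text \<open>Functionals are total on HOL functions; only their values on \<^const>\<open>metric_forms\<close>, and only
  the restrictions of functions to the carrier, are relevant. A current automatically depends only
  on these restrictions (by the mass bound in the first argument, by multilinearity and locality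
  in the others).\<close>

type_synonym 'a functional = "('a \<Rightarrow> real) \<Rightarrow> ('a \<Rightarrow> real) list \<Rightarrow> real"

definition metric_borel :: "'a metric \<Rightarrow> 'a measure" where
  "metric_borel Z = sigma (mspace Z) {U. openin (mtopology_of Z) U}"

definition mass_bound :: "nat \<Rightarrow> 'a metric \<Rightarrow> 'a functional \<Rightarrow> 'a measure \<Rightarrow> bool" where
  "mass_bound m Z T \<mu> \<longleftrightarrow>
     space \<mu> = mspace Z \<and> sets \<mu> = sets (metric_borel Z) \<and> finite_measure \<mu> \<and>
     (\<forall>(f, \<pi>)\<in>metric_forms m Z. \<bar>T f \<pi>\<bar> \<le> prod_list (map (Lip Z) \<pi>) * (\<integral>x. \<bar>f x\<bar> \<partial>\<mu>))"

definition multilinear :: "nat \<Rightarrow> 'a metric \<Rightarrow> 'a functional \<Rightarrow> bool" where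
  "multilinear m Z T \<longleftrightarrow>
     (\<forall>f g \<pi> a b. (f, \<pi>) \<in> metric_forms m Z \<longrightarrow> (g, \<pi>) \<in> metric_forms m Z \<longrightarrow>
        T (\<lambda>x. a * f x + b * g x) \<pi> = a * T f \<pi> + b * T g \<pi>) \<and>
     (\<forall>f \<pi> i p q a b. (f, \<pi>) \<in> metric_forms m Z \<longrightarrow> i < m \<longrightarrow>
        Lipschitz_fun Z p \<longrightarrow> Lipschitz_fun Z q \<longrightarrow>
        T f (\<pi>[i := (\<lambda>x. a * p x + b * q x)]) = a * T f (\<pi>[i := p]) + b * T f (\<pi>[i := q]))"

definition local_functional :: "nat \<Rightarrow> 'a metric \<Rightarrow> 'a functional \<Rightarrow> bool" where
  "local_functional m Z T \<longleftrightarrow>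
     (\<forall>(f, \<pi>)\<in>metric_forms m Z.
        (\<exists>i<m. \<exists>U c. openin (mtopology_of Z) U \<and> {x \<in> mspace Z. f x \<noteq> 0} \<subseteq> U \<and>
                     (\<forall>x\<in>U. (\<pi> ! i) x = c))
        \<longrightarrow> T f \<pi> = 0)"

definition continuous_functional :: "nat \<Rightarrow> 'a metric \<Rightarrow> 'a functional \<Rightarrow> bool" where
  "continuous_functional m Z T \<longleftrightarrow>
     (\<forall>f \<pi> (\<rho> :: nat \<Rightarrow> ('a \<Rightarrow> real) list).
        (f, \<pi>) \<in> metric_forms m Z \<longrightarrow> (\<forall>n. (f, \<rho> n) \<in> metric_forms m Z) \<longrightarrow>
        (\<forall>n. \<forall>i<m. Lip Z (\<rho> n ! i) \<le> 1) \<longrightarrow>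
        (\<forall>i<m. \<forall>x\<in>mspace Z. (\<lambda>n. (\<rho> n ! i) x) \<longlonglongrightarrow> (\<pi> ! i) x) \<longrightarrow>
        (\<lambda>n. T f (\<rho> n)) \<longlonglongrightarrow> T f \<pi>)"

definition is_current :: "nat \<Rightarrow> 'a metric \<Rightarrow> 'a functional \<Rightarrow> bool" where
  "is_current m Z T \<longleftrightarrow>
     multilinear m Z T \<and> local_functional m Z T \<and> continuous_functional m Z T \<and>
     (\<exists>\<mu>. mass_bound m Z T \<mu>)"

definition mass_measure :: "nat \<Rightarrow> 'a metric \<Rightarrow> 'a functional \<Rightarrow> 'a measure" where
  "mass_measure m Z T =
     (THE \<mu>. mass_bound m Z T \<mu> \<and>
        (\<forall>\<nu>. mass_bound m Z T \<nu> \<longrightarrow> (\<forall>B\<in>sets \<mu>. emeasure \<mu> B \<le> emeasure \<nu> B)))"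

definition mass :: "nat \<Rightarrow> 'a metric \<Rightarrow> 'a functional \<Rightarrow> ennreal" where
  "mass m Z T = emeasure (mass_measure m Z T) (mspace Z)"

definition pushforward :: "('a \<Rightarrow> 'b) \<Rightarrow> 'a functional \<Rightarrow> 'b functional" where
  "pushforward \<phi> T = (\<lambda>f \<pi>. T (f \<circ> \<phi>) (map (\<lambda>p. p \<circ> \<phi>) \<pi>))"

definition current_boundary :: "'a functional \<Rightarrow> 'a functional" where
  "current_boundary T = (\<lambda>f \<pi>. T (\<lambda>_. 1) (f # \<pi>))"

definition current_set :: "nat \<Rightarrow> 'a metric \<Rightarrow> 'a functional \<Rightarrow> 'a set" where
  "current_set m Z T =
     {p \<in> mspace Z.
        Liminf (at_right 0)
          (\<lambda>r. ereal (measure (mass_measure m Z T) (mball_of Z p r) / (unit_ball_vol (real m) * r ^ m)))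
        > 0}"


section \<open>Rectifiable and integral currents\<close>

text \<open>Since the dimension varies (\<open>m\<close> and \<open>m + 1\<close>), Euclidean space of dimension \<open>m\<close> is the space of
  functions from \<open>{..<m}\<close> to the reals, in the extensional representation used by \<^const>\<open>PiM\<close>.\<close>

definition euclid :: "nat \<Rightarrow> (nat \<Rightarrow> real) metric" where
  "euclid m = metric ({..<m} \<rightarrow>\<^sub>E UNIV, \<lambda>x y. L2_set (\<lambda>i. x i - y i) {..<m})"

lemma Metric_space_euclid:
  fixes m :: nat
  shows "Metric_space ({..<m} \<rightarrow>\<^sub>E (UNIV :: real set)) (\<lambda>x y. L2_set (\<lambda>i. x i - y i) {..<m})"
proof
  fix x y :: "nat \<Rightarrow> real"
  show "0 \<le> L2_set (\<lambda>i. x i - y i) {..<m}"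
    by (rule L2_set_nonneg)
  show "L2_set (\<lambda>i. x i - y i) {..<m} = L2_set (\<lambda>i. y i - x i) {..<m}"
    by (simp add: L2_set_def power2_commute)
next
  fix x y :: "nat \<Rightarrow> real"
  assume "x \<in> {..<m} \<rightarrow>\<^sub>E UNIV" "y \<in> {..<m} \<rightarrow>\<^sub>E UNIV"
  then show "L2_set (\<lambda>i. x i - y i) {..<m} = 0 \<longleftrightarrow> x = y"
    by (auto simp: L2_set_eq_0_iff intro: PiE_ext)
next
  fix x y z :: "nat \<Rightarrow> real"
  have "L2_set (\<lambda>i. x i - z i) {..<m} = L2_set (\<lambda>i. (x i - y i) + (y i - z i)) {..<m}"
    by simp
  also have "\<dots> \<le> L2_set (\<lambda>i. x i - y i) {..<m} + L2_set (\<lambda>i. y i - z i) {..<m}"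
    by (rule L2_set_triangle_ineq)
  finally show "L2_set (\<lambda>i. x i - z i) {..<m}
      \<le> L2_set (\<lambda>i. x i - y i) {..<m} + L2_set (\<lambda>i. y i - z i) {..<m}" .
qed

lemma mspace_euclid: "mspace (euclid m) = {..<m} \<rightarrow>\<^sub>E UNIV"
  and mdist_euclid: "mdist (euclid m) = (\<lambda>x y. L2_set (\<lambda>i. x i - y i) {..<m})"
  using Metric_space.mspace_metric[OF Metric_space_euclid]
    Metric_space.mdist_metric[OF Metric_space_euclid]
  by (simp_all add: euclid_def)

definition lebesgue_n :: "nat \<Rightarrow> (nat \<Rightarrow> real) measure" where
  "lebesgue_n m = completion (PiM {..<m} (\<lambda>_. lborel))"

text \<open>In the push-forward of \<open>[[\<theta>]]\<close> by a chart defined on \<open>A\<close>, the functions to be differentiated are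
  Lipschitz functions on \<open>A\<close> only, so the gradient is taken within \<open>A\<close>. At almost every point of a
  Borel set \<open>A\<close> (Rademacher, Lebesgue density) it exists, is unique, and is the gradient of any
  Lipschitz extension. Its values elsewhere do not affect the integral.\<close>

definition is_gradient_within ::
  "nat \<Rightarrow> (nat \<Rightarrow> real) set \<Rightarrow> ((nat \<Rightarrow> real) \<Rightarrow> real) \<Rightarrow> (nat \<Rightarrow> real) \<Rightarrow> (nat \<Rightarrow> real) \<Rightarrow> bool" where
  "is_gradient_within m A p x g \<longleftrightarrow>
     g \<in> {..<m} \<rightarrow>\<^sub>E UNIV \<and>
     (\<forall>\<epsilon>>0. \<exists>\<eta>>0. \<forall>y\<in>A. mdist (euclid m) x y < \<eta> \<longrightarrow>
        \<bar>p y - p x - (\<Sum>i<m. g i * (y i - x i))\<bar> \<le> \<epsilon> * mdist (euclid m) x y)"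

definition gradient_within ::
  "nat \<Rightarrow> (nat \<Rightarrow> real) set \<Rightarrow> ((nat \<Rightarrow> real) \<Rightarrow> real) \<Rightarrow> (nat \<Rightarrow> real) \<Rightarrow> nat \<Rightarrow> real" where
  "gradient_within m A p x = (THE g. is_gradient_within m A p x g)"

definition euclidean_current ::
  "nat \<Rightarrow> (nat \<Rightarrow> real) set \<Rightarrow> ((nat \<Rightarrow> real) \<Rightarrow> real) \<Rightarrow> (nat \<Rightarrow> real) functional" where
  "euclidean_current m A \<theta> = (\<lambda>f \<pi>.
     LINT x:A|lebesgue_n m. \<theta> x * f x *
       Determinant.det (Matrix.mat m m (\<lambda>(i, j). gradient_within m A (\<pi> ! i) x j)))"

definition integer_rectifiable :: "nat \<Rightarrow> 'a metric \<Rightarrow> 'a functional \<Rightarrow> bool" where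
  "integer_rectifiable m Z T \<longleftrightarrow>
     is_current m Z T \<and>
     (\<exists>(A :: nat \<Rightarrow> (nat \<Rightarrow> real) set) (\<phi> :: nat \<Rightarrow> (nat \<Rightarrow> real) \<Rightarrow> 'a) (\<theta> :: nat \<Rightarrow> (nat \<Rightarrow> real) \<Rightarrow> nat).
        (\<forall>i. A i \<in> sets (metric_borel (euclid m)) \<and>
             compactin (mtopology_of (euclid m)) (mtopology_of (euclid m) closure_of A i) \<and>
             bilipschitz (submetric (euclid m) (A i)) Z (\<phi> i) \<and>
             set_integrable (lebesgue_n m) (A i) (\<lambda>x. real (\<theta> i x))) \<and>
        disjoint_family (\<lambda>i. \<phi> i ` A i) \<and>
        (let S = (\<lambda>i. pushforward (\<phi> i) (euclidean_current m (A i) (\<lambda>x. real (\<theta> i x))))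
         in (\<forall>(f, \<pi>)\<in>metric_forms m Z. (\<lambda>i. S i f \<pi>) sums T f \<pi>) \<and>
            mass m Z T = (\<Sum>i. mass m Z (S i))))"

text \<open>Currents of dimension \<open>0\<close> have no boundary, so the second condition is void for them.\<close>

definition integral_current :: "nat \<Rightarrow> 'a metric \<Rightarrow> 'a functional \<Rightarrow> bool" where
  "integral_current m Z T \<longleftrightarrow>
     integer_rectifiable m Z T \<and> (m > 0 \<longrightarrow> is_current (m - 1) Z (current_boundary T))"


section \<open>Integral current spaces and the intrinsic flat distance\<close>

text \<open>The space \<open>(X, d, T)\<close> is given by its completion \<open>Xb\<close>, the subset \<open>X\<close> and the current \<open>T\<close> on
  \<open>Xb\<close>. The zero space is the case \<open>X = {}\<close>: then \<open>Xb\<close> is empty and \<open>T\<close> vanishes.\<close>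

definition integral_current_space :: "nat \<Rightarrow> 'a metric \<Rightarrow> 'a set \<Rightarrow> 'a functional \<Rightarrow> bool" where
  "integral_current_space m Xb X T \<longleftrightarrow>
     completion_of Xb X \<and> integral_current m Xb T \<and> current_set m Xb T = X"

definition nonzero_current :: "nat \<Rightarrow> 'a metric \<Rightarrow> 'a functional \<Rightarrow> bool" where
  "nonzero_current m Z T \<longleftrightarrow> (\<exists>(f, \<pi>)\<in>metric_forms m Z. T f \<pi> \<noteq> 0)"

definition precompact_space :: "'a metric \<Rightarrow> 'a set \<Rightarrow> bool" where
  "precompact_space Xb X \<longleftrightarrow> compactin (mtopology_of Xb) (mtopology_of Xb closure_of X)"

text \<open>The type argument \<open>'z\<close> is the universe that provides the points of the ambient complete metric
  spaces \<open>Z\<close>; the Sormani--Wenger distance is obtained for every \<open>'z\<close> with at least continuum many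
  elements (the union of the supports of the currents and of the embedded spaces is separable).\<close>

definition swif_dist ::
  "'z itself \<Rightarrow> nat \<Rightarrow> 'a metric \<Rightarrow> 'a functional \<Rightarrow> 'b metric \<Rightarrow> 'b functional \<Rightarrow> ennreal" where
  "swif_dist (u :: 'z itself) m Y1 T1 Y2 T2 =
     Inf {mass m Z U + mass (m + 1) Z V | (Z :: 'z metric) \<phi>1 \<phi>2 U V.
            mcomplete_of Z \<and>
            isometric_embedding Y1 Z \<phi>1 \<and> isometric_embedding Y2 Z \<phi>2 \<and>
            integral_current m Z U \<and> integral_current (m + 1) Z V \<and>
            (\<forall>(f, \<pi>)\<in>metric_forms m Z.
               pushforward \<phi>1 T1 f \<pi> - pushforward \<phi>2 T2 f \<pi> = U f \<pi> + current_boundary V f \<pi>)}"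

end

theory Submission
  imports Defs
begin

text \<open>
  Approximate a point of the limit by points \<open>a\<close> of the spaces in the sequence. If \<open>a\<close> lies in an
  inner region, it is close to the limit of the inner regions; otherwise it is close to the
  boundary, hence to the limit of the boundaries. Both limits lie in the closure of \<open>Y\<close>, so the
  point does too.
\<close>

text \<open>The Hausdorff distance is an infimum of admissible radii, so once it drops below
  \<open>r\<close> some admissible \<open>s < r\<close> exists, and enlarging \<open>s\<close> to
  \<open>r\<close> keeps both conditions.\<close>

lemma hausdorff_converges_eventually:
  assumes "hausdorff_converges Z A B" and "0 < r"
  shows "\<forall>\<^sub>F k in sequentially.
    (\<forall>a\<in>A k. \<exists>b\<in>B. mdist Z a b < r) \<and> (\<forall>b\<in>B. \<exists>a\<in>A k. mdist Z a b < r)"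
proof -
  have "\<forall>\<^sub>F k in sequentially. hausdorff_dist Z (A k) B < ennreal r"
    using assms by (simp add: hausdorff_converges_def order_tendsto_iff)
  then show ?thesis
  proof eventually_elim
    case (elim k)
    then obtain s where "0 < s" "ennreal s < ennreal r"
      and s: "\<forall>a\<in>A k. \<exists>b\<in>B. mdist Z a b < s" "\<forall>b\<in>B. \<exists>a\<in>A k. mdist Z a b < s"
      unfolding hausdorff_dist_def Inf_less_iff by blast
    then have "s < r"
      by (simp add: ennreal_less_iff)
    with s show ?case
      by (meson less_trans)
  qed
qed

text \<open>A point of \<open>X\<close> outside the inner region has infimal boundary distance at
  most \<open>\<delta> < r\<close>, so some boundary point realises a distance below
  \<open>r\<close>. If the boundary is empty, the infimum is infinite and every point of
  \<open>X\<close> is inner.\<close>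

lemma inner_region_or_near_boundary:
  assumes "a \<in> mspace Xb" and "\<delta> < r" and "0 < r"
  shows "a \<in> inner_region Xb X \<delta> \<or> (\<exists>b\<in>metric_boundary Xb X. mdist Xb a b < r)"
proof (cases "a \<in> X")
  case True
  show ?thesis
  proof (unfold disj_imp, rule impI)
    assume "a \<notin> inner_region Xb X \<delta>"
    with True have "(INF y\<in>metric_boundary Xb X. ereal (mdist Xb a y)) \<le> ereal \<delta>"
      by (simp add: inner_region_def not_less)
    also have "\<dots> < ereal r"
      using assms by simp
    finally show "\<exists>b\<in>metric_boundary Xb X. mdist Xb a b < r"
      by (simp add: INF_less_iff)
  qed
next
  case False
  \<comment> \<open>Here \<open>a\<close> is itself a boundary point, at distance 0 from
    itself.\<close>
  with assms show ?thesis
    by (auto simp: metric_boundary_def Metric_space.mdist_zero[OF Metric_space_mspace_mdist]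
        intro!: bexI[of _ a])
qed

lemma inner_region_subset_closure:
  assumes "X \<subseteq> mspace Xb"
  shows "inner_region Xb X \<delta> \<subseteq> mtopology_of Xb closure_of inner_region Xb X \<delta>"
  using assms by (intro closure_of_subset) (auto simp: inner_region_def)

text \<open>Closure is idempotent, so the approximating points may come from the closure of
  \<open>Y\<close>. This matters because \<open>Xbd\<close> is only known to lie in that
  closure.\<close>

lemma in_closure_of_closure_metric:
  assumes "x \<in> mspace X"
    and "\<And>\<epsilon>. 0 < \<epsilon> \<Longrightarrow> \<exists>y \<in> mtopology_of X closure_of Y. mdist X x y < \<epsilon>"
  shows "x \<in> mtopology_of X closure_of Y"
proof -
  have "\<exists>y \<in> mtopology_of X closure_of Y. y \<in> mball_of X x \<epsilon>" if "0 < \<epsilon>" for \<epsilon>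
    using assms(2)[OF that] assms(1) closure_of_subset_topspace[of "mtopology_of X" Y]
    by auto
  then have "x \<in> mtopology_of X closure_of (mtopology_of X closure_of Y)"
    using assms(1)
    by (simp add: Metric_space.metric_closure_of mtopology_of_def mball_of_def)
  then show ?thesis
    by simp
qed

theorem theorem1p5:
  fixes m :: nat
    and Xb :: "nat \<Rightarrow> 'a metric" and Xs :: "nat \<Rightarrow> 'a set" and Ts :: "nat \<Rightarrow> 'a functional"
    and X :: "'b metric" and Y :: "'b set" and T :: "'b functional"
    and jk :: "nat \<Rightarrow> nat"
    and W :: "'w metric" and e :: "nat \<Rightarrow> 'a \<Rightarrow> 'w" and eX :: "'b \<Rightarrow> 'w"
    and Xbd :: "'b set" and \<delta> :: "nat \<Rightarrow> real" and X\<delta> :: "nat \<Rightarrow> 'b set"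
  assumes current_spaces: "\<And>j. integral_current_space m (Xb j) (Xs j) (Ts j)"
    and precompact: "\<And>j. precompact_space (Xb j) (Xs j)"
    and X_compact: "compact_space (mtopology_of X)"
    and Y_subset: "Y \<subseteq> mspace X"
    and Y_current_space:
      "integral_current_space m (submetric X (mtopology_of X closure_of Y)) Y T"
    and Y_nonzero: "nonzero_current m (submetric X (mtopology_of X closure_of Y)) T"
    and GH: "(\<lambda>j. GH_dist (Xb j) X) \<longlonglongrightarrow> 0"
    and SWIF: "(\<lambda>j. swif_dist TYPE('z) m (Xb j) (Ts j)
                        (submetric X (mtopology_of X closure_of Y)) T) \<longlonglongrightarrow> 0"
    and subsequence: "strict_mono jk"
    \<comment> \<open>the common compact metric space in which the GH limits along the subsequence are taken\<close>
    and W_compact: "compact_space (mtopology_of W)"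
    and e_isometric: "\<And>k. isometric_embedding (Xb (jk k)) W (e k)"
    and eX_isometric: "isometric_embedding X W eX"
    and images_converge:
      "hausdorff_converges W (\<lambda>k. e k ` mspace (Xb (jk k))) (eX ` mspace X)"
    and Xbd_subset: "Xbd \<subseteq> mspace X"
    and boundaries_converge:
      "hausdorff_converges W (\<lambda>k. e k ` metric_boundary (Xb (jk k)) (Xs (jk k))) (eX ` Xbd)"
    and Xbd_in_closure: "Xbd \<subseteq> mtopology_of X closure_of Y"
    and \<delta>_pos: "\<And>i. \<delta> i > 0" and \<delta>_decreasing: "decseq \<delta>" and \<delta>_to_0: "\<delta> \<longlonglongrightarrow> 0"
    and inner_regions_converge:
      "\<And>i. hausdorff_converges W
         (\<lambda>k. e k ` (mtopology_of (Xb (jk k)) closure_of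
                       inner_region (Xb (jk k)) (Xs (jk k)) (\<delta> i)))
         (eX ` X\<delta> i)"
    and inner_limits_in_Y: "\<And>i. X\<delta> i \<subseteq> Y"
  shows "mspace X = mtopology_of X closure_of Y"
proof
  show "mtopology_of X closure_of Y \<subseteq> mspace X"
    using closure_of_subset_topspace[of "mtopology_of X" Y] by simp
next
  let ?C = "mtopology_of X closure_of Y"
  have C: "?C \<subseteq> mspace X"
    using closure_of_subset_topspace[of "mtopology_of X" Y] by simp
  have Y_C: "Y \<subseteq> ?C"
    using Y_subset by (simp add: closure_of_subset)
  show "mspace X \<subseteq> ?C"
  proof (rule subsetI, rule in_closure_of_closure_metric)
    fix x and \<epsilon> :: real
    assume x: "x \<in> mspace X" and \<epsilon>: "0 < \<epsilon>"
    \<comment> \<open>Three gaps will add up: from \<open>x\<close> to \<open>a\<close>, from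
      \<open>a\<close> to \<open>b\<close>, and from \<open>b\<close> to \<open>c\<close>, compared
      in \<open>W\<close>.\<close>
    define r where "r = \<epsilon> / 3"
    have r: "0 < r"
      using \<epsilon> by (simp add: r_def)
    have "\<forall>\<^sub>F i in sequentially. \<delta> i < r"
      using \<delta>_to_0 r by (simp add: order_tendsto_iff)
    \<comment> \<open>The index \<open>i\<close> is fixed before \<open>k\<close>, since the inner
      regions converge for each \<open>i\<close> separately, with no uniformity in
      \<open>i\<close>.\<close>
    then obtain i where i: "\<delta> i < r"
      by (auto simp: eventually_sequentially)
    \<comment> \<open>One \<open>k\<close> serves all three convergences. Whole spaces are used from
      the limit to the sequence, boundaries and inner regions from the sequence to the
      limit.\<close>
    from hausdorff_converges_eventually[OF images_converge r]
      hausdorff_converges_eventually[OF boundaries_converge r]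
      hausdorff_converges_eventually[OF inner_regions_converge[of i] r]
    have "\<forall>\<^sub>F k in sequentially.
        (\<forall>x\<in>mspace X. \<exists>a\<in>mspace (Xb (jk k)). mdist W (e k a) (eX x) < r) \<and>
        (\<forall>b\<in>metric_boundary (Xb (jk k)) (Xs (jk k)). \<exists>c\<in>Xbd. mdist W (e k b) (eX c) < r) \<and>
        (\<forall>a\<in>mtopology_of (Xb (jk k)) closure_of inner_region (Xb (jk k)) (Xs (jk k)) (\<delta> i).
           \<exists>c\<in>X\<delta> i. mdist W (e k a) (eX c) < r)"
      by eventually_elim auto
    then obtain k where
      k_space: "\<And>x. x \<in> mspace X \<Longrightarrow> \<exists>a\<in>mspace (Xb (jk k)). mdist W (e k a) (eX x) < r" and
      k_boundary: "\<And>b. b \<in> metric_boundary (Xb (jk k)) (Xs (jk k)) \<Longrightarrow>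
        \<exists>c\<in>Xbd. mdist W (e k b) (eX c) < r" and
      k_inner: "\<And>a. a \<in> mtopology_of (Xb (jk k)) closure_of
          inner_region (Xb (jk k)) (Xs (jk k)) (\<delta> i) \<Longrightarrow> \<exists>c\<in>X\<delta> i. mdist W (e k a) (eX c) < r"
      by (blast dest: eventually_happens'[OF sequentially_bot])
    obtain a where a: "a \<in> mspace (Xb (jk k))" and ax: "mdist W (e k a) (eX x) < r"
      using k_space[OF x] by blast
    \<comment> \<open>In the inner case \<open>b\<close> is \<open>a\<close> itself and
      \<open>c\<close> lies in \<open>X\<delta> i\<close>; otherwise \<open>b\<close> is a nearby
      boundary point and \<open>c\<close> lies in \<open>Xbd\<close>.\<close>
    have "\<exists>b c. b \<in> mspace (Xb (jk k)) \<and> c \<in> ?C \<and> mdist (Xb (jk k)) a b < r \<and>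
      mdist W (e k b) (eX c) < r"
      using inner_region_or_near_boundary[OF a i r]
    proof
      assume "a \<in> inner_region (Xb (jk k)) (Xs (jk k)) (\<delta> i)"
      moreover have "Xs (jk k) \<subseteq> mspace (Xb (jk k))"
        using current_spaces[of "jk k"]
        by (simp add: integral_current_space_def completion_of_def)
      ultimately obtain c where "c \<in> X\<delta> i" "mdist W (e k a) (eX c) < r"
        using inner_region_subset_closure k_inner by blast
      with a r inner_limits_in_Y Y_C show ?thesis
        by (intro exI[of _ a] exI[of _ c]) (auto simp: Metric_space.mdist_zero[OF Metric_space_mspace_mdist])
    next
      assume "\<exists>b\<in>metric_boundary (Xb (jk k)) (Xs (jk k)). mdist (Xb (jk k)) a b < r"
      then show ?thesis
        using k_boundary Xbd_in_closure by (fastforce simp: metric_boundary_def)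
    qed
    then obtain b c where b: "b \<in> mspace (Xb (jk k))" and c: "c \<in> ?C"
      and ab: "mdist (Xb (jk k)) a b < r" and bc: "mdist W (e k b) (eX c) < r"
      by blast
    \<comment> \<open>The gaps are measured in different spaces; the isometric embeddings bring them
      all into \<open>W\<close>, where the triangle inequality applies.\<close>
    have e_ab: "mdist W (e k a) (e k b) = mdist (Xb (jk k)) a b"
      and e_mem: "e k a \<in> mspace W" "e k b \<in> mspace W"
      using e_isometric[of k] a b by (auto simp: isometric_embedding_def)
    have eX_xc: "mdist W (eX x) (eX c) = mdist X x c"
      and eX_mem: "eX x \<in> mspace W" "eX c \<in> mspace W"
      using eX_isometric x c C by (auto simp: isometric_embedding_def)
    have "mdist X x c \<le> mdist W (eX x) (e k a) + (mdist W (e k a) (e k b) + mdist W (e k b) (eX c))"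
      using mdist_triangle[OF eX_mem(1) e_mem(1) eX_mem(2)]
        mdist_triangle[OF e_mem eX_mem(2)] eX_xc by linarith
    also have "\<dots> < \<epsilon>"
      using ax ab bc e_ab by (simp add: mdist_commute r_def)
    finally show "\<exists>y\<in>?C. mdist X x y < \<epsilon>"
      using c by blast
  qed simp
qed

end
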